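(* Let $t\in\mathbb Q$, $t\neq0,\pm1,\pm2$. There are elements of order $4$ in the sequence group $\mathcal L(t)$ only in the circular case, i.e. when $t^2-4=-a^2$ for some rational $a$. In that case the elements of order $4$ are $G=[2\ t+a]$ and $H=[2\ t-a]$. For any such rational $t$ (circular or not) there are no elements of order $8$ in $\mathcal L(t)$.
   Context: For $t\in\mathbb Q$ let $D_t=\begin{pmatrix}0&-1\\1&t\end{pmatrix}$ and let $\mathcal R(t)$ be the commutative ring of all $2\times2$ rational matrices commuting with $D_t$; its elements are the matrices $[x_0\ x_1]:=\begin{pmatrix}x_1-tx_0&-x_0\\ x_0&x_1\end{pmatrix}$, $x_0,x_1\in\mathbb Q$. The sequence group $\mathcal L(t)$ is the commutative group of elements of $\mathcal R(t)$ with nonzero determinant modulo multiplication by nonzero rational scalars; elements of $\mathcal R(t)$ with nonzero determinant are used to denote their classes. *)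

theory Defs
  imports "HOL-Analysis.Determinants" "HOL-Algebra.Multiplicative_Group"
begin

definition D_mat :: "rat \<Rightarrow> rat^2^2" where
  "D_mat t = vector [vector [0, -1], vector [1, t]]"

definition R_ring :: "rat \<Rightarrow> (rat^2^2) ring" where
  "R_ring t = \<lparr>carrier = {A. A ** D_mat t = D_mat t ** A},
     mult = (**), one = mat 1, zero = 0, add = (+)\<rparr>"

definition elt :: "rat \<Rightarrow> rat \<Rightarrow> rat \<Rightarrow> rat^2^2" where
  "elt t x0 x1 = vector [vector [x1 - t * x0, - x0], vector [x0, x1]]"

definition R_nonsing :: "rat \<Rightarrow> (rat^2^2) monoid" where
  "R_nonsing t = \<lparr>carrier = {A \<in> carrier (R_ring t). det A \<noteq> 0},
     mult = mult (R_ring t), one = one (R_ring t)\<rparr>"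

text \<open>Multiplying by the scalar \<open>c\<close> is multiplying by the scalar matrix \<open>mat c\<close>, so
  identifying matrices up to nonzero scalars is factoring by this subgroup.\<close>

definition scalar_mats :: "(rat^2^2) set" where
  "scalar_mats = {mat c | c. c \<noteq> 0}"

definition seq_group :: "rat \<Rightarrow> (rat^2^2) set monoid" where
  "seq_group t = R_nonsing t Mod scalar_mats"

definition seq_class :: "rat \<Rightarrow> rat^2^2 \<Rightarrow> (rat^2^2) set" where
  "seq_class t A = scalar_mats #>\<^bsub>R_nonsing t\<^esub> A"

lemma carrier_R_ring: "carrier (R_ring t) = {elt t x0 x1 | x0 x1. True}"
proof (intro Set.set_eqI iffI)
  fix A assume "A \<in> carrier (R_ring t)"
  then have "A = elt t (A$2$1) (A$2$2)"
    by (auto simp: R_ring_def D_mat_def elt_def vec_eq_iff forall_2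
        matrix_matrix_mult_def sum_2 vector_2 algebra_simps)
  then show "A \<in> {elt t x0 x1 | x0 x1. True}" by blast
next
  fix A assume "A \<in> {elt t x0 x1 | x0 x1. True}"
  then show "A \<in> carrier (R_ring t)"
    by (auto simp: R_ring_def D_mat_def elt_def vec_eq_iff forall_2
        matrix_matrix_mult_def sum_2 vector_2 algebra_simps)
qed

lemma elt_mult:
  "elt t x0 x1 ** elt t y0 y1 = elt t (x0 * y1 + x1 * y0 - t * x0 * y0) (x1 * y1 - x0 * y0)"
  by (simp add: elt_def vec_eq_iff forall_2 matrix_matrix_mult_def sum_2 vector_2 algebra_simps)

lemma elt_add: "elt t x0 x1 + elt t y0 y1 = elt t (x0 + y0) (x1 + y1)"
  by (simp add: elt_def vec_eq_iff forall_2 vector_2 algebra_simps)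

lemma mat_elt: "(mat c :: rat^2^2) = elt t 0 c"
  by (simp add: elt_def vec_eq_iff forall_2 mat_def vector_2)

lemma zero_elt: "(0 :: rat^2^2) = elt t 0 0"
  by (simp add: elt_def vec_eq_iff forall_2 vector_2)

lemma det_elt: "det (elt t x0 x1) = x1 * x1 - t * x0 * x1 + x0 * x0"
  by (simp add: elt_def det_2 vector_2 algebra_simps)

lemma cring_R_ring: "cring (R_ring t)"
proof (rule cringI)
  have neg: "elt t (-x0) (-x1) + elt t x0 x1 = 0" for x0 x1
    by (simp add: elt_add zero_elt[of t])
  have simps [simp]: "mult (R_ring t) = (**)" "one (R_ring t) = mat 1"
    "add (R_ring t) = (+)" "zero (R_ring t) = 0"
    by (simp_all add: R_ring_def)
  have elt_in: "elt t a b \<in> carrier (R_ring t)" for a b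
    by (auto simp: carrier_R_ring)
  have elt_E: "\<exists>a b. x = elt t a b" if "x \<in> carrier (R_ring t)" for x
    using that by (auto simp: carrier_R_ring)
  show "abelian_group (R_ring t)"
  proof (rule abelian_groupI)
    show "\<exists>y\<in>carrier (R_ring t). y \<oplus>\<^bsub>R_ring t\<^esub> x = \<zero>\<^bsub>R_ring t\<^esub>"
      if "x \<in> carrier (R_ring t)" for x
    proof -
      obtain a b where "x = elt t a b" using elt_E \<open>x \<in> carrier _\<close> by blast
      then show ?thesis using elt_in[of "-a" "-b"] neg[of a b] by auto
    qed
  qed (auto dest!: elt_E simp: elt_add elt_in zero_elt[of t] add_ac)
  show "comm_monoid (R_ring t)"
    by (rule comm_monoidI)
      (auto dest!: elt_E simp: elt_mult elt_in mat_elt[of _ t] algebra_simps)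
  show "(x \<oplus>\<^bsub>R_ring t\<^esub> y) \<otimes>\<^bsub>R_ring t\<^esub> z
      = x \<otimes>\<^bsub>R_ring t\<^esub> z \<oplus>\<^bsub>R_ring t\<^esub> y \<otimes>\<^bsub>R_ring t\<^esub> z" for x y z
    by (simp add: vec_eq_iff matrix_matrix_mult_def distrib_right sum.distrib)
qed

lemma comm_group_R_nonsing: "comm_group (R_nonsing t)"
proof (rule comm_groupI)
  have simps [simp]: "mult (R_nonsing t) = (**)" "one (R_nonsing t) = mat 1"
    by (simp_all add: R_nonsing_def R_ring_def)
  have car: "carrier (R_nonsing t) = {elt t x0 x1 | x0 x1. det (elt t x0 x1) \<noteq> 0}"
    by (auto simp: R_nonsing_def carrier_R_ring)
  show "x \<otimes>\<^bsub>R_nonsing t\<^esub> y \<in> carrier (R_nonsing t)"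
    if "x \<in> carrier (R_nonsing t)" "y \<in> carrier (R_nonsing t)" for x y
  proof -
    have "det (x ** y) \<noteq> 0" using that by (auto simp: car det_mul)
    moreover obtain u v where "x ** y = elt t u v"
      using \<open>x \<in> carrier _\<close> \<open>y \<in> carrier _\<close> by (auto simp: car elt_mult)
    ultimately show ?thesis by (auto simp: car)
  qed
  show "\<one>\<^bsub>R_nonsing t\<^esub> \<in> carrier (R_nonsing t)"
    by (force simp: car mat_elt[of _ t] det_elt)
  show "x \<otimes>\<^bsub>R_nonsing t\<^esub> y \<otimes>\<^bsub>R_nonsing t\<^esub> z
      = x \<otimes>\<^bsub>R_nonsing t\<^esub> (y \<otimes>\<^bsub>R_nonsing t\<^esub> z)" for x y z
    by (simp add: matrix_mul_assoc)
  show "x \<otimes>\<^bsub>R_nonsing t\<^esub> y = y \<otimes>\<^bsub>R_nonsing t\<^esub> x"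
    if "x \<in> carrier (R_nonsing t)" "y \<in> carrier (R_nonsing t)" for x y
    using that by (auto simp: car elt_mult algebra_simps)
  show "\<one>\<^bsub>R_nonsing t\<^esub> \<otimes>\<^bsub>R_nonsing t\<^esub> x = x" for x
    by simp
  show "\<exists>y\<in>carrier (R_nonsing t). y \<otimes>\<^bsub>R_nonsing t\<^esub> x = \<one>\<^bsub>R_nonsing t\<^esub>"
    if "x \<in> carrier (R_nonsing t)" for x
  proof -
    obtain x0 x1 where x: "x = elt t x0 x1" and d: "det (elt t x0 x1) \<noteq> 0"
      using \<open>x \<in> carrier _\<close> by (auto simp: car)
    define n where "n = det (elt t x0 x1)"
    define y where "y = elt t (- x0 / n) ((x1 - t * x0) / n)"
    have n: "n \<noteq> 0" "n = x1 * x1 - t * x0 * x1 + x0 * x0"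
      using d by (auto simp: n_def det_elt)
    have "(x1 * x1 - t * x0 * x1 + x0 * x0) / n = 1"
      using n by simp
    then have "(x1 - t * x0) / n * x1 - - x0 / n * x0 = 1"
      by (simp add: add_divide_distrib diff_divide_distrib algebra_simps)
    moreover have "- x0 / n * x1 + (x1 - t * x0) / n * x0 - t * (- x0 / n) * x0 = 0"
      using n(1) by (simp add: field_simps)
    ultimately have yx: "y ** x = mat 1"
      using n(1) by (simp add: y_def x elt_mult mat_elt[of _ t])
    then have "det y * det x = 1" by (metis det_mul det_I)
    then have "det y \<noteq> 0" by auto
    then have "y \<in> carrier (R_nonsing t)" unfolding car y_def by blast
    then show ?thesis using yx by auto
  qed
qed

lemma normal_scalar_mats: "scalar_mats \<lhd> R_nonsing t"
proof -
  interpret comm_group "R_nonsing t" by (rule comm_group_R_nonsing)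
  have mm: "(mat a :: rat^2^2) ** mat b = mat (a * b)" for a b
    by (simp add: mat_elt[of _ t] elt_mult)
  have sub: "scalar_mats \<subseteq> carrier (R_nonsing t)"
    by (auto simp: scalar_mats_def R_nonsing_def carrier_R_ring mat_elt[of _ t] det_elt)
  have "subgroup scalar_mats (R_nonsing t)"
  proof (rule subgroupI)
    show "scalar_mats \<noteq> {}" by (auto simp: scalar_mats_def intro: exI[of _ 1])
    show "a \<otimes>\<^bsub>R_nonsing t\<^esub> b \<in> scalar_mats"
      if "a \<in> scalar_mats" "b \<in> scalar_mats" for a b
      using that by (auto simp: scalar_mats_def R_nonsing_def R_ring_def mm)
    show "inv\<^bsub>R_nonsing t\<^esub> a \<in> scalar_mats" if "a \<in> scalar_mats" for a
    proof -
      obtain c where c: "a = mat c" "c \<noteq> 0"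
        using \<open>a \<in> scalar_mats\<close> by (auto simp: scalar_mats_def)
      have i: "mat (1 / c) \<in> scalar_mats" using c by (auto simp: scalar_mats_def)
      have "mat (1 / c) \<otimes>\<^bsub>R_nonsing t\<^esub> a = \<one>\<^bsub>R_nonsing t\<^esub>"
        using c by (simp add: R_nonsing_def R_ring_def mm)
      then have "inv\<^bsub>R_nonsing t\<^esub> a = mat (1 / c)"
        using inv_equality i that sub by blast
      then show ?thesis using i by simp
    qed
  qed (use sub in auto)
  then show ?thesis by (rule subgroup_imp_normal)
qed

lemma comm_group_seq_group: "comm_group (seq_group t)"
  unfolding seq_group_def
  by (intro comm_group.abelian_FactGroup comm_group_R_nonsing normal.axioms(1) normal_scalar_mats)

lemma carrier_seq_group:
  "carrier (seq_group t) = {seq_class t (elt t x0 x1) | x0 x1. det (elt t x0 x1) \<noteq> 0}"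
  by (auto simp: seq_group_def FactGroup_def RCOSETS_def seq_class_def R_nonsing_def carrier_R_ring)

end

theory Submission
  imports Defs
begin

text \<open>
  An invertible element \<open>[x0 x1]\<close> is \<open>x1 + x0 B\<close> with \<open>B\<^sup>2 = - t B - 1\<close>; up to the scalar
  \<open>1/2\<close> it is \<open>u + v \<surd>(t\<^sup>2 - 4)\<close>, where \<open>v = x0\<close> and \<open>u = 2 x1 - t x0\<close>. Two such elements
  have the same class exactly when they are the same point of the projective line over
  the rationals, the class is trivial exactly when \<open>v = 0\<close>, and squaring sends \<open>(u, v)\<close> to
  \<open>(u\<^sup>2 + (t\<^sup>2 - 4) v\<^sup>2, 2 u v)\<close>.

  A class has order \<open>4\<close> when its square is the only class of order \<open>2\<close>, the one with
  \<open>u = 0\<close>; that is, when \<open>v \<noteq> 0\<close> and \<open>u\<^sup>2 = (4 - t\<^sup>2) v\<^sup>2\<close>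
  (\<open>ord_seq_class_eq_4_iff\<close>). Such a pair makes \<open>4 - t\<^sup>2\<close> the square of \<open>a = u / v\<close>, and
  conversely \<open>u = \<plusminus> a v\<close> has the two projective solutions \<open>[2 t+a]\<close> and \<open>[2 t-a]\<close>.

  If a class had order \<open>8\<close>, its square would have order \<open>4\<close>. The elements of order \<open>4\<close> have
  determinant \<open>2\<close> up to a rational square, like \<open>1 + i\<close> in the Gaussian field, whereas the
  determinant of a square is a square; so \<open>2\<close> would be a rational square
  (\<open>rat_square_neq_2\<close>).
\<close>

section \<open>Irrationality of the square root of two\<close>

lemma rat_square_neq_2: "(r :: rat)\<^sup>2 \<noteq> 2"
proof
  assume r: "r\<^sup>2 = 2"
  obtain m n where q: "quotient_of r = (m, n)" by (cases "quotient_of r")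
  have n: "n > 0" and cop: "coprime m n"
    using q quotient_of_denom_pos quotient_of_coprime by blast+
  have "of_int m = r * of_int n"
    using quotient_of_div[OF q] n by simp
  then have "(of_int (m\<^sup>2) :: rat) = of_int (2 * n\<^sup>2)"
    using r by (simp add: power_mult_distrib)
  then have mn: "m\<^sup>2 = 2 * n\<^sup>2" by (simp only: of_int_eq_iff)
  then have "even m" by (metis dvd_triv_left even_power)
  then obtain k where "m = 2 * k" ..
  with mn have "n\<^sup>2 = 2 * k\<^sup>2" by (simp add: power_mult_distrib)
  then have "even n" by (metis dvd_triv_left even_power)
  with \<open>even m\<close> cop show False by (auto simp: coprime_def)
qed

section \<open>The sequence group as a set of points of the projective line\<close>

lemma elt_eq_iff: "elt t x0 x1 = elt t y0 y1 \<longleftrightarrow> x0 = y0 \<and> x1 = y1"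
  by (auto simp: elt_def vec_eq_iff forall_2 vector_2)

lemma elt_mem_R_nonsing: "elt t x0 x1 \<in> carrier (R_nonsing t) \<longleftrightarrow> det (elt t x0 x1) \<noteq> 0"
  by (auto simp: R_nonsing_def carrier_R_ring)

lemma seq_class_elt: "seq_class t (elt t x0 x1) = {elt t (c * x0) (c * x1) | c. c \<noteq> 0}"
  by (auto simp: seq_class_def r_coset_def scalar_mats_def R_nonsing_def R_ring_def
      mat_elt[of _ t] elt_mult)

lemma seq_class_eq_iff:
  assumes "det (elt t x0 x1) \<noteq> 0" "det (elt t y0 y1) \<noteq> 0"
  shows "seq_class t (elt t x0 x1) = seq_class t (elt t y0 y1) \<longleftrightarrow> x0 * y1 = x1 * y0"
proof
  assume "seq_class t (elt t x0 x1) = seq_class t (elt t y0 y1)"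
  moreover have "elt t x0 x1 \<in> seq_class t (elt t x0 x1)"
    unfolding seq_class_elt by (force intro: exI[of _ 1])
  ultimately show "x0 * y1 = x1 * y0"
    by (auto simp: seq_class_elt elt_eq_iff)
next
  assume cross: "x0 * y1 = x1 * y0"
  have "\<exists>c. c \<noteq> 0 \<and> x0 = c * y0 \<and> x1 = c * y1"
  proof (cases "y0 = 0")
    case True
    then have "y1 \<noteq> 0" using assms(2) by (auto simp: det_elt)
    with True cross have "x0 = 0" by simp
    then have "x1 \<noteq> 0" using assms(1) by (auto simp: det_elt)
    with \<open>y1 \<noteq> 0\<close> True \<open>x0 = 0\<close> show ?thesis by (intro exI[of _ "x1 / y1"]) simp
  next
    case False
    have "x0 \<noteq> 0"
    proof
      assume "x0 = 0"
      with cross False have "x1 = 0" by simp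
      with \<open>x0 = 0\<close> assms(1) show False by (simp add: det_elt)
    qed
    with False cross show ?thesis by (intro exI[of _ "x0 / y0"]) (simp add: field_simps)
  qed
  then obtain c where c: "c \<noteq> 0" "x0 = c * y0" "x1 = c * y1" by blast
  have "\<exists>d'. d' \<noteq> 0 \<and> d * y0 = d' * x0 \<and> d * y1 = d' * x1" if "d \<noteq> 0" for d
    using c that by (intro exI[of _ "d / c"]) simp
  moreover have "\<exists>d'. d' \<noteq> 0 \<and> d * x0 = d' * y0 \<and> d * x1 = d' * y1" if "d \<noteq> 0" for d
    using c that by (intro exI[of _ "d * c"]) simp
  ultimately show "seq_class t (elt t x0 x1) = seq_class t (elt t y0 y1)"
    unfolding seq_class_elt by (auto simp: elt_eq_iff) metis+
qed

lemma one_seq_group: "\<one>\<^bsub>seq_group t\<^esub> = seq_class t (elt t 0 1)"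
  by (auto simp: seq_group_def FactGroup_def seq_class_elt scalar_mats_def mat_elt[of _ t])

lemma seq_class_mult:
  assumes "det (elt t x0 x1) \<noteq> 0" "det (elt t y0 y1) \<noteq> 0"
  shows "seq_class t (elt t x0 x1) \<otimes>\<^bsub>seq_group t\<^esub> seq_class t (elt t y0 y1)
    = seq_class t (elt t x0 x1 ** elt t y0 y1)"
  using normal.rcos_sum[OF normal_scalar_mats, of "elt t x0 x1" t "elt t y0 y1"] assms
  by (simp add: seq_group_def FactGroup_def seq_class_def elt_mem_R_nonsing)
     (simp add: R_nonsing_def R_ring_def)

lemma seq_class_mem_carrier:
  "det (elt t x0 x1) \<noteq> 0 \<Longrightarrow> seq_class t (elt t x0 x1) \<in> carrier (seq_group t)"
  by (auto simp: carrier_seq_group)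

lemma seq_class_eq_one_iff:
  assumes "det (elt t x0 x1) \<noteq> 0"
  shows "seq_class t (elt t x0 x1) = \<one>\<^bsub>seq_group t\<^esub> \<longleftrightarrow> x0 = 0"
  using seq_class_eq_iff[OF assms, of 0 1] by (simp add: one_seq_group det_elt)

section \<open>Squares and elements of order four\<close>

text \<open>The product formula specialised to \<open>[x0 x1]\<^sup>2\<close>: in the coordinates
  \<open>v = x0\<close>, \<open>u = 2 x1 - t x0\<close> the first entry is \<open>u v\<close> and the second one yields
  the new \<open>u\<close> as \<open>(u\<^sup>2 + (t\<^sup>2 - 4) v\<^sup>2) / 2\<close>.\<close>

lemma seq_class_square:
  assumes "det (elt t x0 x1) \<noteq> 0"
  shows "seq_class t (elt t x0 x1) [^]\<^bsub>seq_group t\<^esub> (2::nat)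
      = seq_class t (elt t (x0 * (2 * x1 - t * x0)) (x1\<^sup>2 - x0\<^sup>2))"
    and "det (elt t (x0 * (2 * x1 - t * x0)) (x1\<^sup>2 - x0\<^sup>2)) \<noteq> 0"
proof -
  interpret comm_group "seq_group t" by (rule comm_group_seq_group)
  have sq: "elt t x0 x1 ** elt t x0 x1 = elt t (x0 * (2 * x1 - t * x0)) (x1\<^sup>2 - x0\<^sup>2)"
    by (simp add: elt_mult elt_eq_iff power2_eq_square algebra_simps)
  show "seq_class t (elt t x0 x1) [^]\<^bsub>seq_group t\<^esub> (2::nat)
      = seq_class t (elt t (x0 * (2 * x1 - t * x0)) (x1\<^sup>2 - x0\<^sup>2))"
    using seq_class_mult[OF assms assms] seq_class_mem_carrier[OF assms]
    by (simp add: sq numeral_2_eq_2)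
  show "det (elt t (x0 * (2 * x1 - t * x0)) (x1\<^sup>2 - x0\<^sup>2)) \<noteq> 0"
    using assms by (simp add: det_mul flip: sq)
qed

lemma (in group) ord_eq_4_iff:
  assumes "x \<in> carrier G"
  shows "ord x = 4 \<longleftrightarrow> x [^] (2::nat) \<noteq> \<one> \<and> x [^] (4::nat) = \<one>"
proof -
  have "k dvd 4 \<longleftrightarrow> k dvd 2 \<or> k = 4" for k :: nat
  proof
    assume "k dvd 4"
    then have "k \<le> 4" by (rule dvd_imp_le) simp
    then have "k \<in> {0, 1, 2, 3, 4}" by auto
    with \<open>k dvd 4\<close> show "k dvd 2 \<or> k = 4" by auto
  qed (auto intro: dvd_trans[of _ 2])
  moreover have "\<not> (4::nat) dvd 2" by simp
  ultimately show ?thesis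
    using pow_eq_id[OF assms] by metis
qed

text \<open>Having order \<open>4\<close> is the condition that the square is nontrivial, \<open>u v \<noteq> 0\<close>, and has
  square one, \<open>u\<^sup>2 + (t\<^sup>2 - 4) v\<^sup>2 = 0\<close>. The hypothesis on \<open>t\<close> makes \<open>t\<^sup>2 - 4\<close> nonzero, so
  that under the second condition the first one reduces to \<open>v \<noteq> 0\<close>.\<close>

lemma ord_seq_class_eq_4_iff:
  assumes t: "t \<noteq> 2" "t \<noteq> -2" and det: "det (elt t x0 x1) \<noteq> 0"
  shows "group.ord (seq_group t) (seq_class t (elt t x0 x1)) = 4
    \<longleftrightarrow> x0 \<noteq> 0 \<and> (2 * x1 - t * x0)\<^sup>2 = (4 - t\<^sup>2) * x0\<^sup>2"
proof -
  interpret comm_group "seq_group t" by (rule comm_group_seq_group)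
  define x where "x = seq_class t (elt t x0 x1)"
  define u where "u = 2 * x1 - t * x0"
  define p where "p = x0 * u"
  define q where "q = x1\<^sup>2 - x0\<^sup>2"
  have x: "x \<in> carrier (seq_group t)"
    unfolding x_def by (rule seq_class_mem_carrier[OF det])
  have x2: "x [^]\<^bsub>seq_group t\<^esub> (2::nat) = seq_class t (elt t p q)"
    and det2: "det (elt t p q) \<noteq> 0"
    using seq_class_square[OF det] by (simp_all add: x_def p_def q_def u_def)
  have "x [^]\<^bsub>seq_group t\<^esub> (4::nat)
      = (x [^]\<^bsub>seq_group t\<^esub> (2::nat)) [^]\<^bsub>seq_group t\<^esub> (2::nat)"
    by (simp add: nat_pow_pow x)
  also have "\<dots> = seq_class t (elt t (p * (2 * q - t * p)) (q\<^sup>2 - p\<^sup>2))"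
    unfolding x2 by (rule seq_class_square(1)[OF det2])
  finally have x4: "x [^]\<^bsub>seq_group t\<^esub> (4::nat) = \<one>\<^bsub>seq_group t\<^esub>
      \<longleftrightarrow> p = 0 \<or> 2 * q - t * p = 0"
    using seq_class_eq_one_iff[OF seq_class_square(2)[OF det2]] by simp
  have "t\<^sup>2 - 4 = (t - 2) * (t + 2)"
    by (simp add: power2_eq_square algebra_simps)
  with t have d: "4 - t\<^sup>2 \<noteq> 0"
    by (metis add_eq_0_iff2 diff_eq_eq add_0 eq_iff_diff_eq_0 mult_eq_0_iff)
  have "2 * (2 * q - t * p) = u\<^sup>2 - (4 - t\<^sup>2) * x0\<^sup>2"
    by (simp add: p_def q_def u_def power2_eq_square algebra_simps)
  then have "2 * q - t * p = 0 \<longleftrightarrow> u\<^sup>2 = (4 - t\<^sup>2) * x0\<^sup>2"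
    by (metis eq_iff_diff_eq_0 mult_eq_0_iff zero_neq_numeral)
  moreover have "p \<noteq> 0 \<longleftrightarrow> x0 \<noteq> 0" if "u\<^sup>2 = (4 - t\<^sup>2) * x0\<^sup>2"
    using that d by (auto simp: p_def)
  ultimately have "group.ord (seq_group t) x = 4
      \<longleftrightarrow> x0 \<noteq> 0 \<and> u\<^sup>2 = (4 - t\<^sup>2) * x0\<^sup>2"
    using ord_eq_4_iff[OF x] x4 x2 seq_class_eq_one_iff[OF det2] by auto
  then show ?thesis by (simp add: x_def u_def)
qed

section \<open>Absence of elements of order eight\<close>

text \<open>With \<open>d = 4 - t\<^sup>2\<close>, a square of order \<open>4\<close> gives \<open>(u\<^sup>2 - d v\<^sup>2)\<^sup>2 = 4 d u\<^sup>2 v\<^sup>2\<close>. Adding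
  \<open>4 d u\<^sup>2 v\<^sup>2\<close> on both sides completes the left one to \<open>(u\<^sup>2 + d v\<^sup>2)\<^sup>2\<close>, which is sixteen times
  the squared determinant, so that \<open>(u\<^sup>2 + d v\<^sup>2)\<^sup>2 = 2 (u\<^sup>2 - d v\<^sup>2)\<^sup>2\<close>.\<close>

lemma ord_seq_class_neq_8:
  assumes t: "t \<noteq> 2" "t \<noteq> -2" and det: "det (elt t x0 x1) \<noteq> 0"
  shows "group.ord (seq_group t) (seq_class t (elt t x0 x1)) \<noteq> 8"
proof
  interpret comm_group "seq_group t" by (rule comm_group_seq_group)
  define x where "x = seq_class t (elt t x0 x1)"
  define u where "u = 2 * x1 - t * x0"
  define p where "p = x0 * u"
  define q where "q = x1\<^sup>2 - x0\<^sup>2"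
  define m where "m = u\<^sup>2 - (4 - t\<^sup>2) * x0\<^sup>2"
  define n where "n = u\<^sup>2 + (4 - t\<^sup>2) * x0\<^sup>2"
  assume "group.ord (seq_group t) (seq_class t (elt t x0 x1)) = 8"
  then have "group.ord (seq_group t) (x [^]\<^bsub>seq_group t\<^esub> (2::nat)) = 4"
    using ord_pow_gen[of x 2] seq_class_mem_carrier[OF det]
    by (simp add: x_def gcd_nat.absorb2)
  moreover have "x [^]\<^bsub>seq_group t\<^esub> (2::nat) = seq_class t (elt t p q)"
    and det2: "det (elt t p q) \<noteq> 0"
    using seq_class_square[OF det] by (simp_all add: x_def p_def q_def u_def)
  ultimately have "(2 * q - t * p)\<^sup>2 = (4 - t\<^sup>2) * p\<^sup>2"
    using ord_seq_class_eq_4_iff[OF t det2] by simp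
  moreover have "m = 2 * (2 * q - t * p)"
    by (simp add: m_def p_def q_def u_def power2_eq_square algebra_simps)
  ultimately have "m\<^sup>2 = 4 * ((4 - t\<^sup>2) * p\<^sup>2)"
    by (simp only: power_mult_distrib) simp
  moreover have "n\<^sup>2 = m\<^sup>2 + 4 * ((4 - t\<^sup>2) * p\<^sup>2)"
    by (simp add: m_def n_def p_def power2_eq_square algebra_simps)
  ultimately have nm: "n\<^sup>2 = 2 * m\<^sup>2" by simp
  have "n = 4 * det (elt t x0 x1)"
    by (simp add: n_def u_def det_elt power2_eq_square algebra_simps)
  with det have "n \<noteq> 0" by simp
  with nm have "m \<noteq> 0" by auto
  with nm have "(n / m)\<^sup>2 = 2" by (simp add: power_divide)
  then show False using rat_square_neq_2 by blast
qed

section \<open>The elements of order four and eight\<close>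

theorem proposition18:
  fixes t :: rat
  assumes "t \<noteq> 0" "t \<noteq> 1" "t \<noteq> -1" "t \<noteq> 2" "t \<noteq> -2"
  shows "((\<exists>x\<in>carrier (seq_group t). group.ord (seq_group t) x = 4)
            \<longrightarrow> (\<exists>a::rat. t\<^sup>2 - 4 = - (a\<^sup>2)))
       \<and> (\<forall>a::rat. t\<^sup>2 - 4 = - (a\<^sup>2) \<longrightarrow>
            {x \<in> carrier (seq_group t). group.ord (seq_group t) x = 4}
              = {seq_class t (elt t 2 (t + a)), seq_class t (elt t 2 (t - a))})
       \<and> \<not> (\<exists>x\<in>carrier (seq_group t). group.ord (seq_group t) x = 8)"
proof (intro conjI impI allI)
  note ord4 = ord_seq_class_eq_4_iff[OF \<open>t \<noteq> 2\<close> \<open>t \<noteq> -2\<close>]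
  assume "\<exists>x\<in>carrier (seq_group t). group.ord (seq_group t) x = 4"
  then obtain x0 x1 where "det (elt t x0 x1) \<noteq> 0"
    "group.ord (seq_group t) (seq_class t (elt t x0 x1)) = 4"
    by (auto simp: carrier_seq_group)
  then have "x0 \<noteq> 0" "(2 * x1 - t * x0)\<^sup>2 = (4 - t\<^sup>2) * x0\<^sup>2"
    using ord4 by blast+
  then have "t\<^sup>2 - 4 = - (((2 * x1 - t * x0) / x0)\<^sup>2)"
    by (simp add: power_divide)
  then show "\<exists>a. t\<^sup>2 - 4 = - (a\<^sup>2)" ..
next
  note ord4 = ord_seq_class_eq_4_iff[OF \<open>t \<noteq> 2\<close> \<open>t \<noteq> -2\<close>]
  fix a :: rat
  assume a: "t\<^sup>2 - 4 = - (a\<^sup>2)"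
  have a2: "4 - t\<^sup>2 = a\<^sup>2" using a by (simp add: algebra_simps)
  have "a \<noteq> 0"
  proof
    assume "a = 0"
    with a have "(t - 2) * (t + 2) = 0" by (simp add: power2_eq_square algebra_simps)
    with assms show False by (auto simp: eq_neg_iff_add_eq_0)
  qed
  have det: "det (elt t 2 (t + b)) \<noteq> 0" if "b\<^sup>2 = a\<^sup>2" for b
  proof -
    have "det (elt t 2 (t + b)) = b\<^sup>2 + (4 - t\<^sup>2)"
      by (simp add: det_elt power2_eq_square algebra_simps)
    then show ?thesis using that a2 \<open>a \<noteq> 0\<close> by simp
  qed
  have detp: "det (elt t 2 (t + a)) \<noteq> 0" and detm: "det (elt t 2 (t - a)) \<noteq> 0"
    using det[of a] det[of "- a"] by simp_all
  show "{x \<in> carrier (seq_group t). group.ord (seq_group t) x = 4}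
      = {seq_class t (elt t 2 (t + a)), seq_class t (elt t 2 (t - a))}" (is "?L = ?R")
  proof
    show "?R \<subseteq> ?L"
      using detp detm ord4[OF detp] ord4[OF detm] a2
      by (auto simp: seq_class_mem_carrier power2_eq_square algebra_simps)
    show "?L \<subseteq> ?R"
    proof
      fix x assume "x \<in> ?L"
      then obtain x0 x1 where x: "x = seq_class t (elt t x0 x1)"
        and d: "det (elt t x0 x1) \<noteq> 0" and "group.ord (seq_group t) x = 4"
        by (auto simp: carrier_seq_group)
      then have "(2 * x1 - t * x0)\<^sup>2 = (a * x0)\<^sup>2"
        using ord4[OF d] a2 by (simp add: power_mult_distrib)
      then have "2 * x1 - t * x0 = a * x0 \<or> 2 * x1 - t * x0 = - (a * x0)"
        by (simp only: power2_eq_iff)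
      then have "x0 * (t + a) = x1 * 2 \<or> x0 * (t - a) = x1 * 2"
        by (auto simp: algebra_simps)
      then show "x \<in> ?R"
        using seq_class_eq_iff[OF d detp] seq_class_eq_iff[OF d detm] x by auto
    qed
  qed
next
  show "\<not> (\<exists>x\<in>carrier (seq_group t). group.ord (seq_group t) x = 8)"
    using ord_seq_class_neq_8[OF \<open>t \<noteq> 2\<close> \<open>t \<noteq> -2\<close>] by (auto simp: carrier_seq_group)
qed

end
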